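(* Let $\mathcal M^{(1)},\mathcal M^{(2)}$ be nonzero Hilbert spaces and for $k=1,2$ let $W^{(k)}\in\mathcal B(\ell^2_{\mathcal M^{(k)}})$ be an operator valued unilateral weighted shift with weights $\{W^{(k)}_n\}_{n\ge0}$. Assume that for $k=1,2$ and all $n\ge0$: $\ker W^{(1)}_n=\{0\}$, $W^{(k)}_n$ has dense range, and $|W^{(k)}_n|$ commutes with $W^{(k)}_m$ whenever $m<n$. Then $W^{(1)}\cong W^{(2)}$ if and only if there exists a unitary isomorphism $U_0:\mathcal M^{(1)}\to\mathcal M^{(2)}$ with $|W^{(1)}_n|=U_0^*|W^{(2)}_n|U_0$ for all $n\ge0$.
   Context: For a nonzero Hilbert space $\mathcal M$, $\ell^2_{\mathcal M}$ is the space of square-summable sequences in $\mathcal M$; the operator valued unilateral weighted shift with uniformly bounded weights $\{W_n\}\subseteq\mathcal B(\mathcal M)$ is $W(h_0,h_1,\ldots)=(0,W_0h_0,W_1h_1,\ldots)$. $|A|=(A^*A)^{1/2}$. $\cong$ denotes unitary equivalence. *)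

theory Defs
  imports "HOL-Analysis.Analysis"
begin

class complex_vector = real_vector +
  fixes scaleC :: "complex \<Rightarrow> 'a \<Rightarrow> 'a"
  assumes scaleC_add_right: "scaleC a (x + y) = scaleC a x + scaleC a y"
    and scaleC_add_left: "scaleC (a + b) x = scaleC a x + scaleC b x"
    and scaleC_scaleC: "scaleC a (scaleC b x) = scaleC (a * b) x"
    and scaleC_one: "scaleC 1 x = x"
    and scaleR_scaleC: "scaleR r x = scaleC (complex_of_real r) x"

class complex_inner = complex_vector + real_normed_vector +
  fixes cinner :: "'a \<Rightarrow> 'a \<Rightarrow> complex"
  assumes cinner_conj_sym: "cinner x y = cnj (cinner y x)"
    and cinner_add_right: "cinner x (y + z) = cinner x y + cinner x z"
    and cinner_scaleC_right: "cinner x (scaleC c y) = c * cinner x y"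
    and cinner_self_real: "Im (cinner x x) = 0"
    and cinner_self_nonneg: "0 \<le> Re (cinner x x)"
    and cinner_self_eq_zero: "cinner x x = 0 \<longleftrightarrow> x = 0"
    and norm_eq_sqrt_cinner: "norm x = sqrt (Re (cinner x x))"

class chilbert_space = complex_inner + complete_space

definition clinear :: "('a::complex_vector \<Rightarrow> 'b::complex_vector) \<Rightarrow> bool" where
  "clinear f \<longleftrightarrow> (\<forall>x y. f (x + y) = f x + f y) \<and> (\<forall>c x. f (scaleC c x) = scaleC c (f x))"

definition bounded_clinear :: "('a::complex_inner \<Rightarrow> 'b::complex_inner) \<Rightarrow> bool" where
  "bounded_clinear f \<longleftrightarrow> clinear f \<and> (\<exists>K. \<forall>x. norm (f x) \<le> norm x * K)"

definition adj :: "('a::complex_inner \<Rightarrow> 'b::complex_inner) \<Rightarrow> ('b \<Rightarrow> 'a)" where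
  "adj A = (THE B. \<forall>x y. cinner (A x) y = cinner x (B y))"

definition positive_op :: "('a::complex_inner \<Rightarrow> 'a) \<Rightarrow> bool" where
  "positive_op P \<longleftrightarrow> (\<forall>x. Im (cinner x (P x)) = 0 \<and> 0 \<le> Re (cinner x (P x)))"

definition absop :: "('a::complex_inner \<Rightarrow> 'b::complex_inner) \<Rightarrow> ('a \<Rightarrow> 'a)" where
  "absop A = (THE P. bounded_clinear P \<and> positive_op P \<and> (\<forall>x. P (P x) = adj A (A x)))"

definition unitary_iso :: "('a::complex_inner \<Rightarrow> 'b::complex_inner) \<Rightarrow> bool" where
  "unitary_iso U \<longleftrightarrow> bounded_clinear U \<and> bij U \<and> (\<forall>x. norm (U x) = norm x)"

definition l2seq :: "(nat \<Rightarrow> 'a::complex_inner) set" where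
  "l2seq = {h. summable (\<lambda>n. (norm (h n))\<^sup>2)}"

definition l2norm :: "(nat \<Rightarrow> 'a::complex_inner) \<Rightarrow> real" where
  "l2norm h = sqrt (\<Sum>n. (norm (h n))\<^sup>2)"

definition l2_unitary :: "((nat \<Rightarrow> 'a::complex_inner) \<Rightarrow> (nat \<Rightarrow> 'b::complex_inner)) \<Rightarrow> bool" where
  "l2_unitary U \<longleftrightarrow> bij_betw U l2seq l2seq
     \<and> (\<forall>h\<in>l2seq. \<forall>g\<in>l2seq. U (\<lambda>n. h n + g n) = (\<lambda>n. U h n + U g n))
     \<and> (\<forall>h\<in>l2seq. \<forall>c. U (\<lambda>n. scaleC c (h n)) = (\<lambda>n. scaleC c (U h n)))
     \<and> (\<forall>h\<in>l2seq. l2norm (U h) = l2norm h)"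

definition weight_seq :: "(nat \<Rightarrow> 'a::complex_inner \<Rightarrow> 'a) \<Rightarrow> bool" where
  "weight_seq W \<longleftrightarrow> (\<forall>n. bounded_clinear (W n)) \<and> (\<exists>K. \<forall>n x. norm (W n x) \<le> K * norm x)"

definition wshift :: "(nat \<Rightarrow> 'a \<Rightarrow> 'a::complex_inner) \<Rightarrow> (nat \<Rightarrow> 'a) \<Rightarrow> (nat \<Rightarrow> 'a)" where
  "wshift W h = (\<lambda>k. if k = 0 then 0 else W (k - 1) (h (k - 1)))"

definition shift_unitarily_equiv ::
  "(nat \<Rightarrow> 'a \<Rightarrow> 'a::complex_inner) \<Rightarrow> (nat \<Rightarrow> 'b \<Rightarrow> 'b::complex_inner) \<Rightarrow> bool" where
  "shift_unitarily_equiv W1 W2 \<longleftrightarrow>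
     (\<exists>U. l2_unitary U \<and> (\<forall>h\<in>l2seq. U (wshift W1 h) = wshift W2 (U h)))"

end

theory Submission
  imports Defs
begin

text \<open>A unitary intertwining the two shifts is lower triangular because the weights
  have dense range; so is its inverse, hence it is a diagonal of unitaries \<open>D\<^sub>n\<close> with
  \<open>D\<^sub>n\<^sub>+\<^sub>1 W1\<^sub>n = W2\<^sub>n D\<^sub>n\<close>. By uniqueness of positive square roots \<open>D\<^sub>n\<close> intertwines
  \<open>|W1\<^sub>n|\<close> and \<open>|W2\<^sub>n|\<close>, and the commutation hypotheses together with injectivity of
  \<open>W2\<^sub>m\<close>, which \<open>W2\<^sub>m D\<^sub>m = D\<^sub>m\<^sub>+\<^sub>1 W1\<^sub>m\<close> inherits from \<open>W1\<^sub>m\<close>, carry this from \<open>D\<^sub>n\<close> down to \<open>D\<^sub>0\<close>.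
  Conversely, if \<open>D\<^sub>n\<close> intertwines \<open>|W1\<^sub>k|\<close> and \<open>|W2\<^sub>k|\<close> for all \<open>k \<ge> n\<close>, then
  \<open>W1\<^sub>n x \<mapsto> W2\<^sub>n D\<^sub>n x\<close> is isometric between dense subspaces, and its extension \<open>D\<^sub>n\<^sub>+\<^sub>1\<close>
  intertwines them for all \<open>k > n\<close>.\<close>

\<comment> \<open>Complex inner product spaces, bounded linear maps and unitaries\<close>
subclass (in chilbert_space) banach ..

lemma scaleC_zero_right [simp]: "scaleC c (0::'a::complex_vector) = 0"
proof -
  have "scaleC c (0::'a) + scaleC c 0 = scaleC c 0 + 0"
    by (simp flip: scaleC_add_right)
  then show ?thesis
    by (rule add_left_imp_eq)
qed

lemma cinner_add_left: "cinner (x + y) z = cinner x z + cinner y z"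
  by (metis cinner_add_right cinner_conj_sym complex_cnj_add)

lemma cinner_scaleC_left: "cinner (scaleC c x) y = cnj c * cinner x y"
  by (metis cinner_conj_sym cinner_scaleC_right complex_cnj_mult)

lemma cinner_scaleR_right: "cinner x (r *\<^sub>R y) = r *\<^sub>R cinner x y"
  by (simp add: scaleR_scaleC cinner_scaleC_right scaleR_conv_of_real)

lemma cinner_scaleR_left: "cinner (r *\<^sub>R x) y = r *\<^sub>R cinner x y"
  by (simp add: scaleR_scaleC cinner_scaleC_left scaleR_conv_of_real)

lemma cinner_self: "cinner x x = complex_of_real ((norm x)\<^sup>2)"
  by (simp add: complex_eq_iff cinner_self_real norm_eq_sqrt_cinner cinner_self_nonneg)

lemma Re_cinner_commute: "Re (cinner x y) = Re (cinner y x)"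
  by (metis cinner_conj_sym cnj.sel(1))

text \<open>Lets an identity between real parts that holds for all vectors pass to imaginary parts,
  by rotating one argument.\<close>

lemma Im_cinner: "Im (cinner x y) = Re (cinner x (scaleC (- \<i>) y))"
  by (simp add: cinner_scaleC_right)

lemma norm_scaleC: "norm (scaleC c x) = cmod c * norm (x::'a::complex_inner)"
proof -
  have "cinner (scaleC c x) (scaleC c x) = (c * cnj c) * cinner x x"
    by (simp add: cinner_scaleC_left cinner_scaleC_right)
  then have "complex_of_real ((norm (scaleC c x))\<^sup>2) = complex_of_real ((cmod c * norm x)\<^sup>2)"
    unfolding cinner_self complex_norm_square [symmetric] by (simp add: power_mult_distrib)
  then have "(norm (scaleC c x))\<^sup>2 = (cmod c * norm x)\<^sup>2"
    by (simp only: of_real_eq_iff)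
  then show ?thesis
    by (simp add: power2_eq_iff_nonneg)
qed

lemma norm_add_sq: "(norm (x + y))\<^sup>2 = (norm x)\<^sup>2 + (norm y)\<^sup>2 + 2 * Re (cinner x y)"
  for x y :: "'a::complex_inner"
proof -
  have "(norm (x + y))\<^sup>2 = Re (cinner (x + y) (x + y))"
    by (simp add: cinner_self)
  also have "\<dots> = (norm x)\<^sup>2 + (norm y)\<^sup>2 + Re (cinner x y) + Re (cinner y x)"
    unfolding cinner_add_left cinner_add_right by (simp add: cinner_self del: of_real_power)
  also have "Re (cinner y x) = Re (cinner x y)"
    by (rule Re_cinner_commute)
  finally show ?thesis
    by simp
qed

text \<open>The triangle inequality is part of \<open>real_normed_vector\<close>, so Cauchy-Schwarz
  is read off from its square, reversing the usual order of deduction.\<close>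

lemma Re_cinner_le: "Re (cinner x y) \<le> norm x * norm y" for x y :: "'a::complex_inner"
proof -
  have "(norm (x + y))\<^sup>2 \<le> (norm x + norm y)\<^sup>2"
    by (simp add: norm_triangle_ineq power_mono)
  then show ?thesis
    by (simp add: norm_add_sq power2_sum)
qed

lemma cmod_cinner_le: "cmod (cinner x y) \<le> norm x * norm y" for x y :: "'a::complex_inner"
proof -
  \<comment> \<open>This scalar rotates the inner product onto the nonnegative real axis. It has
    modulus 1, or is 0 when the inner product vanishes.\<close>
  define c where "c = cnj (sgn (cinner x y))"
  have "c * cinner x y = cmod (cinner x y)"
    by (simp add: c_def complex_sgn_def scaleR_conv_of_real complex_norm_square power2_eq_square
        mult.commute field_simps flip: complex_norm_square)
  then have "cmod (cinner x y) = Re (cinner x (scaleC c y))"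
    by (simp add: cinner_scaleC_right)
  also have "\<dots> \<le> norm x * (cmod c * norm y)"
    using Re_cinner_le [of x "scaleC c y"] by (simp add: norm_scaleC)
  also have "\<dots> \<le> norm x * (1 * norm y)"
    by (intro mult_left_mono mult_right_mono) (auto simp: c_def norm_sgn)
  finally show ?thesis
    by simp
qed

interpretation cinner: bounded_bilinear "cinner :: 'a::complex_inner \<Rightarrow> 'a \<Rightarrow> complex"
proof
  show "\<exists>K. \<forall>x y :: 'a. cmod (cinner x y) \<le> norm x * norm y * K"
    by (intro exI [of _ 1]) (simp add: cmod_cinner_le)
qed (simp_all add: cinner_add_left cinner_add_right cinner_scaleR_left cinner_scaleR_right)

lemma cinner_ext:
  assumes "\<And>z. cinner z x = cinner z y"
  shows "x = y"
proof -
  have "cinner (x - y) (x - y) = 0"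
    using assms [of "x - y"] by (simp add: cinner.diff_right)
  then show ?thesis
    by (simp add: cinner_self_eq_zero)
qed

lemma bounded_linear_scaleC: "bounded_linear (scaleC c :: 'a::complex_inner \<Rightarrow> 'a)"
  by (rule bounded_linear_intro [where K = "cmod c"])
    (auto simp: scaleC_add_right scaleR_scaleC scaleC_scaleC norm_scaleC mult.commute)

lemma scaleC_diff_right: "scaleC c (x - y) = scaleC c x - scaleC c (y::'a::complex_inner)"
  by (rule linear_diff [OF bounded_linear.linear [OF bounded_linear_scaleC]])

lemma clinearD:
  assumes "clinear f"
  shows clinear_add: "f (x + y) = f x + f y" and clinear_scaleC: "f (scaleC c x) = scaleC c (f x)"
  using assms by (auto simp: clinear_def)

lemma clinear_imp_linear: "clinear f \<Longrightarrow> linear f"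
  by (rule linearI) (auto simp: clinear_def scaleR_scaleC)

lemma clinear_diff: "clinear f \<Longrightarrow> f (x - y) = f x - f y"
  by (simp add: clinear_imp_linear linear_diff)

lemma bounded_clinear_bounded_linear: "bounded_clinear f \<Longrightarrow> bounded_linear f"
  unfolding bounded_clinear_def
  by (metis clinear_imp_linear bounded_linear.intro bounded_linear_axioms.intro)

lemma bounded_clinear_clinear: "bounded_clinear f \<Longrightarrow> clinear f"
  by (simp add: bounded_clinear_def)

lemma bounded_clinearI: "clinear f \<Longrightarrow> (\<And>x. norm (f x) \<le> norm x * K) \<Longrightarrow> bounded_clinear f"
  unfolding bounded_clinear_def by blast

lemma bounded_clinear_iff: "bounded_clinear f \<longleftrightarrow> clinear f \<and> bounded_linear f"
  by (metis bounded_clinear_bounded_linear bounded_clinear_def bounded_linear.bounded)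

lemma bounded_clinear_compose:
  "bounded_clinear f \<Longrightarrow> bounded_clinear g \<Longrightarrow> bounded_clinear (\<lambda>x. f (g x))"
  unfolding bounded_clinear_iff by (auto simp: clinear_def bounded_linear_compose)

text \<open>Polarisation: the norm of \<open>x + y\<close> determines the real part of the inner
  product, and complex linearity supplies the imaginary part.\<close>

lemma isometry_cinner:
  assumes "clinear U" and iso: "\<And>x. norm (U x) = norm (x::'a::complex_inner)"
  shows "cinner (U x) (U y) = cinner x (y::'a)"
proof -
  have Re: "Re (cinner (U x) (U y)) = Re (cinner x y)" for x y
    using norm_add_sq [of x y] norm_add_sq [of "U x" "U y"] iso
    by (simp flip: clinear_add [OF assms(1)])
  moreover have "Im (cinner (U x) (U y)) = Im (cinner x y)"
    unfolding Im_cinner by (simp add: Re flip: clinear_scaleC [OF assms(1)])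
  ultimately show ?thesis
    by (simp add: complex_eq_iff)
qed

lemma unitary_isoD:
  assumes "unitary_iso U"
  shows "clinear U" "bij U" "norm (U x) = norm x" "bounded_clinear U"
    "cinner (U x) (U y) = cinner x y"
  using assms by (auto simp: unitary_iso_def bounded_clinear_clinear intro: isometry_cinner)

lemma unitary_isoI: "clinear U \<Longrightarrow> bij U \<Longrightarrow> (\<And>x. norm (U x) = norm x) \<Longrightarrow> unitary_iso U"
  unfolding unitary_iso_def by (auto intro: bounded_clinearI [of U 1])

lemma unitary_iso_inv:
  assumes U: "unitary_iso U"
  shows "unitary_iso (inv U)"
proof (rule unitary_isoI)
  have eq: "x = inv U y \<longleftrightarrow> U x = y" for x y
    using unitary_isoD(2) [OF U] by (metis bij_inv_eq_iff)
  have UV: "U (inv U y) = y" for y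
    by (simp flip: eq)
  show "clinear (inv U)"
    unfolding clinear_def
    by (auto simp: UV clinear_add [OF unitary_isoD(1) [OF U]]
        clinear_scaleC [OF unitary_isoD(1) [OF U]] eq intro!: eq [THEN iffD2, symmetric])
  show "bij (inv U)"
    using unitary_isoD(2) [OF U] by (rule bij_imp_bij_inv)
  show "norm (inv U x) = norm x" for x
    by (metis UV unitary_isoD(3) [OF U])
qed

section \<open>Adjoints\<close>

text \<open>Meant for minimising sequences: \<open>e n\<close> bounds the excess of the
  \<open>n\<close>-th value over the infimum, and the first assumption is what a parallelogram law
  yields.\<close>

lemma convergent_minimising_sequence:
  fixes X :: "nat \<Rightarrow> 'a::chilbert_space"
  assumes "\<And>m n. (norm (X m - X n))\<^sup>2 \<le> c * (e m + e n)"
    and "e \<longlonglongrightarrow> (0::real)"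
  shows "convergent X"
proof -
  have "Cauchy X"
  proof (rule metric_CauchyI)
    fix r :: real
    assume "0 < r"
    have "(\<lambda>n. \<bar>c\<bar> * \<bar>e n\<bar>) \<longlonglongrightarrow> \<bar>c\<bar> * \<bar>0\<bar>"
      by (intro tendsto_intros assms)
    then have "\<forall>\<^sub>F n in sequentially. \<bar>c\<bar> * \<bar>e n\<bar> < r\<^sup>2 / 2"
      using \<open>0 < r\<close> by (intro order_tendstoD(2)) auto
    then obtain M where M: "\<And>n. M \<le> n \<Longrightarrow> \<bar>c\<bar> * \<bar>e n\<bar> < r\<^sup>2 / 2"
      by (auto simp: eventually_sequentially)
    have "dist (X m) (X n) < r" if "M \<le> m" "M \<le> n" for m n
    proof -
      have "(norm (X m - X n))\<^sup>2 \<le> c * (e m + e n)"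
        by (rule assms)
      also have "\<dots> \<le> \<bar>c\<bar> * \<bar>e m\<bar> + \<bar>c\<bar> * \<bar>e n\<bar>"
        by (simp add: distrib_left) (metis abs_ge_self abs_mult add_mono)
      also have "\<dots> < r\<^sup>2"
        using M [OF that(1)] M [OF that(2)] by simp
      finally show ?thesis
        using \<open>0 < r\<close> by (simp add: dist_norm power2_less_imp_less)
    qed
    then show "\<exists>M. \<forall>m\<ge>M. \<forall>n\<ge>M. dist (X m) (X n) < r"
      by blast
  qed
  then show ?thesis
    by (simp add: Cauchy_convergent_iff)
qed

text \<open>The first-variation test: near \<open>t = 0\<close> the linear term dominates and
  changes sign with \<open>t\<close> unless its coefficient vanishes.\<close>

lemma linear_coeff_eq_zero:
  fixes a b :: real
  assumes "\<And>t. 0 \<le> t\<^sup>2 * a + t * b"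
  shows "b = 0"
proof (rule ccontr)
  assume "b \<noteq> 0"
  define c where "c = \<bar>a\<bar> + 1"
  have c: "0 < c" "a < c"
    by (auto simp: c_def)
  have "0 \<le> (- b / c)\<^sup>2 * a + (- b / c) * b"
    by (rule assms)
  also have "\<dots> = (b\<^sup>2 / c\<^sup>2) * (a - c)"
    using c by (simp add: field_simps power2_eq_square)
  also have "\<dots> < 0"
    using c \<open>b \<noteq> 0\<close> by (intro mult_pos_neg) auto
  finally show False
    by simp
qed

text \<open>The representing vector minimises \<open>\<parallel>x\<parallel>\<^sup>2 - 2 Re (f x)\<close>; by the parallelogram law every
  minimising sequence is Cauchy.\<close>
lemma riesz_representation:
  fixes f :: "'a::chilbert_space \<Rightarrow> complex"
  assumes add: "\<And>x y. f (x + y) = f x + f y"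
    and scale: "\<And>c x. f (scaleC c x) = c * f x"
    and bound: "\<And>x. cmod (f x) \<le> K * norm x"
  shows "\<exists>z. \<forall>x. f x = cinner z x"
proof -
  have bl: "bounded_linear f"
    by (rule bounded_linear_intro [where K = K])
      (use bound in \<open>auto simp: add scaleR_scaleC scale scaleR_conv_of_real mult.commute\<close>)
  have fR: "f (r *\<^sub>R x) = r *\<^sub>R f x" for r x
    using bl by (simp add: bounded_linear.linear linear_scale)
  define \<phi> where "\<phi> x = (norm x)\<^sup>2 - 2 * Re (f x)" for x
  have below: "- K\<^sup>2 \<le> \<phi> x" for x
  proof -
    have "Re (f x) \<le> K * norm x"
      using complex_Re_le_cmod bound by (rule order_trans)
    moreover have "0 \<le> (norm x - K)\<^sup>2"
      by simp
    ultimately show ?thesis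
      by (simp add: \<phi>_def power2_diff mult_ac)
  qed
  define d where "d = (INF x. \<phi> x)"
  have bdd: "bdd_below (range \<phi>)"
    using below by (auto simp: bdd_below_def)
  have d_le: "d \<le> \<phi> x" for x
    unfolding d_def using bdd by (auto intro: cINF_lower)
  have "\<exists>x. \<phi> x < d + inverse (Suc n)" for n
    using cInf_lessD [of "range \<phi>" "d + inverse (Suc n)"] by (auto simp: d_def)
  then obtain X where X: "\<And>n. \<phi> (X n) < d + inverse (Suc n)"
    by metis
  have "(norm (x - y))\<^sup>2 \<le> 2 * ((\<phi> x - d) + (\<phi> y - d))" for x y
  proof -
    have "4 * d \<le> 4 * \<phi> ((1/2) *\<^sub>R (x + y))"
      using d_le by simp
    also have "\<dots> = (norm (x + y))\<^sup>2 - 4 * (Re (f x) + Re (f y))"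
      by (simp add: \<phi>_def fR add power_divide) (simp add: field_simps)
    finally show ?thesis
      using norm_add_sq [of x y] norm_add_sq [of x "- y"]
      by (simp add: \<phi>_def cinner.minus_right)
  qed
  then have "(norm (X m - X n))\<^sup>2 \<le> 2 * (inverse (Suc m) + inverse (Suc n))" for m n
    using X [of m] X [of n] by (smt (verit, best))
  then have "convergent X"
    by (rule convergent_minimising_sequence) (rule LIMSEQ_inverse_real_of_nat)
  then obtain z where z: "X \<longlonglongrightarrow> z"
    by (auto simp: convergent_def)
  have "(\<lambda>n. \<phi> (X n)) \<longlonglongrightarrow> \<phi> z"
    unfolding \<phi>_def by (intro tendsto_intros z bounded_linear.tendsto [OF bl])
  moreover have "(\<lambda>n. d + inverse (real (Suc n))) \<longlonglongrightarrow> d + 0"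
    by (intro tendsto_intros LIMSEQ_inverse_real_of_nat)
  ultimately have "\<phi> z \<le> d + 0"
    by (rule LIMSEQ_le) (use X less_imp_le in blast)
  then have min: "\<phi> z \<le> \<phi> x" for x
    using d_le [of x] by simp
  \<comment> \<open>Perturb the minimiser by real multiples of \<open>x\<close>. The change of
    \<open>\<phi>\<close> is a nonnegative quadratic in \<open>t\<close> without constant
    term.\<close>
  have Re: "Re (f x) = Re (cinner z x)" for x
  proof -
    have "0 \<le> t\<^sup>2 * (norm x)\<^sup>2 + t * (2 * Re (cinner z x) - 2 * Re (f x))" for t
      using min [of "z + t *\<^sub>R x"]
      by (simp add: \<phi>_def norm_add_sq add fR cinner_scaleR_right
          power_mult_distrib algebra_simps)
    then have "2 * Re (cinner z x) - 2 * Re (f x) = 0"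
      by (rule linear_coeff_eq_zero)
    then show ?thesis
      by simp
  qed
  have "Im (f x) = Im (cinner z x)" for x
    using Re [of "scaleC (- \<i>) x"] by (simp add: scale cinner_scaleC_right)
  then have "\<forall>x. f x = cinner z x"
    using Re by (simp add: complex_eq_iff)
  then show ?thesis ..
qed

text \<open>Resolves the definite description in \<open>adj\<close>: vectors are determined by their
  inner products, so there is at most one candidate.\<close>

lemma adj_eqI:
  assumes "\<And>x y. cinner (A x) y = cinner x (B y)"
  shows "adj A = B"
  unfolding adj_def
proof (rule the_equality)
  show "\<forall>x y. cinner (A x) y = cinner x (B y)"
    using assms by blast
  show "C = B" if "\<forall>x y. cinner (A x) y = cinner x (C y)" for C
    using that assms by (intro ext cinner_ext) metis
qed

text \<open>Existence of the adjoint: for each \<open>y\<close>, Riesz represents the functional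
  that sends \<open>x\<close> to \<open>cinner y (A x)\<close>. This is where completeness of the
  domain enters.\<close>

lemma cinner_adj:
  fixes A :: "'a::chilbert_space \<Rightarrow> 'b::complex_inner"
  assumes A: "bounded_clinear A"
  shows "cinner (A x) y = cinner x (adj A y)"
proof -
  obtain K where K: "\<And>x. norm (A x) \<le> norm x * K"
    using A by (auto simp: bounded_clinear_def)
  have "\<exists>z. \<forall>x. cinner y (A x) = cinner z x" for y
  proof (rule riesz_representation)
    show "cmod (cinner y (A x)) \<le> (norm y * K) * norm x" for x
      using cmod_cinner_le [of y "A x"] mult_left_mono [OF K [of x] norm_ge_zero [of y]]
      by (simp add: mult_ac)
  qed (auto simp: clinearD [OF bounded_clinear_clinear [OF A]] cinner_add_right
      cinner_scaleC_right)
  then obtain B where "\<And>x y. cinner y (A x) = cinner (B y) x"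
    by metis
  then have "cinner (A x) y = cinner x (B y)" for x y
    by (metis cinner_conj_sym)
  then show ?thesis
    using adj_eqI [of A B] by simp
qed

lemma bounded_clinear_adj:
  fixes A :: "'a::chilbert_space \<Rightarrow> 'b::complex_inner"
  assumes A: "bounded_clinear A"
  shows "bounded_clinear (adj A)"
proof -
  obtain K where K: "\<And>x. norm (A x) \<le> norm x * K"
    using A by (auto simp: bounded_clinear_def)
  show ?thesis
  proof (rule bounded_clinearI)
    show "clinear (adj A)"
      unfolding clinear_def
    proof (intro conjI allI; rule cinner_ext)
      show "cinner z (adj A (x + y)) = cinner z (adj A x + adj A y)" for z x y
        by (simp add: cinner_add_right flip: cinner_adj [OF A])
      show "cinner z (adj A (scaleC c x)) = cinner z (scaleC c (adj A x))" for z c x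
        by (simp add: cinner_scaleC_right flip: cinner_adj [OF A])
    qed
    \<comment> \<open>The absolute value is taken because \<open>K\<close> could be negative on a
      trivial domain. The case split permits division by \<open>norm (adj A y)\<close> at the
      end.\<close>
    show "norm (adj A y) \<le> norm y * \<bar>K\<bar>" for y
    proof (cases "adj A y = 0")
      case False
      have "(norm (adj A y))\<^sup>2 = Re (cinner (A (adj A y)) y)"
        by (simp add: cinner_adj [OF A] cinner_self)
      also have "\<dots> \<le> norm (A (adj A y)) * norm y"
        by (rule Re_cinner_le)
      also have "\<dots> \<le> norm (adj A y) * K * norm y"
        by (intro mult_right_mono K) simp
      also have "\<dots> \<le> norm (adj A y) * \<bar>K\<bar> * norm y"
        by (intro mult_right_mono mult_left_mono) auto
      finally show ?thesis
        using False by (simp add: power2_eq_square mult_ac)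
    qed simp
  qed
qed

lemma adj_unitary:
  assumes "unitary_iso U"
  shows "adj U = inv U"
proof (rule adj_eqI)
  show "cinner (U x) y = cinner x (inv U y)" for x y
    by (metis assms unitary_isoD(2) unitary_isoD(5) bij_inv_eq_iff)
qed

section \<open>Positive operators and their square roots\<close>

text \<open>The quadratic form is real. Evaluating it at \<open>x + y\<close> settles the imaginary
  parts, and replacing \<open>y\<close> by \<open>scaleC \<i> y\<close> turns this into the claim
  for real parts.\<close>

lemma positive_op_symmetric:
  assumes lin: "clinear P" and pos: "positive_op P"
  shows "cinner (P x) y = cinner x (P y)"
proof -
  have Im: "Im (cinner (P x) y) = Im (cinner x (P y))" for x y
  proof -
    have 0: "Im (cinner z (P z)) = 0" for z
      using pos by (simp add: positive_op_def)
    have "Im (cinner x (P y)) + Im (cinner y (P x)) = 0"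
      using 0 [of "x + y"] 0 [of x] 0 [of y]
      by (simp add: clinear_add [OF lin] cinner_add_left cinner_add_right)
    moreover have "Im (cinner (P x) y) = - Im (cinner y (P x))"
      by (metis cinner_conj_sym cnj.sel(2))
    ultimately show ?thesis
      by simp
  qed
  moreover have "Re (cinner (P x) y) = Re (cinner x (P y))"
    using Im [of x "scaleC \<i> y"] by (simp add: clinear_scaleC [OF lin] cinner_scaleC_right)
  ultimately show ?thesis
    by (simp add: complex_eq_iff)
qed

text \<open>Expand the form at \<open>K x - P x\<close>.\<close>
lemma positive_op_norm_sq_le:
  assumes lin: "clinear P" and pos: "positive_op P"
    and le: "\<And>y. Re (cinner y (P y)) \<le> K * (norm y)\<^sup>2" and "0 < K"
  shows "(norm (P x))\<^sup>2 \<le> K * Re (cinner x (P x))"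
proof -
  have "0 \<le> Re (cinner (K *\<^sub>R x - P x) (P (K *\<^sub>R x - P x)))"
    using pos by (simp add: positive_op_def)
  also have "\<dots> = K * (K * Re (cinner x (P x))) - 2 * (K * (norm (P x))\<^sup>2)
      + Re (cinner (P x) (P (P x)))"
  proof -
    have "cinner x (P (P x)) = cinner (P x) (P x)"
      by (rule positive_op_symmetric [OF lin pos, symmetric])
    then show ?thesis
      by (simp add: linear_diff linear_scale clinear_imp_linear [OF lin] cinner.diff_left
          cinner.diff_right cinner_scaleR_left cinner_scaleR_right)
        (simp add: cinner_self right_diff_distrib del: of_real_power)
  qed
  also have "\<dots> \<le> K * (K * Re (cinner x (P x))) - K * (norm (P x))\<^sup>2"
    using le [of "P x"] by simp
  finally have "K * (norm (P x))\<^sup>2 \<le> K * (K * Re (cinner x (P x)))"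
    by simp
  then show ?thesis
    using \<open>0 < K\<close> by simp
qed

text \<open>An operator bound for \<open>P\<close> also bounds its quadratic form, so
  \<open>positive_op_norm_sq_le\<close> estimates the squared norm of \<open>P x\<close> by a
  multiple of the form at \<open>x\<close>.\<close>

lemma positive_op_eq_0:
  assumes P: "bounded_clinear P" and pos: "positive_op P" and 0: "Re (cinner x (P x)) = 0"
  shows "P x = 0"
proof -
  obtain K where "0 < K" and K: "\<And>x. norm (P x) \<le> norm x * K"
    using bounded_linear.pos_bounded [OF bounded_clinear_bounded_linear [OF P]] by blast
  have "Re (cinner y (P y)) \<le> K * (norm y)\<^sup>2" for y
    using Re_cinner_le [of y "P y"] mult_left_mono [OF K [of y] norm_ge_zero [of y]]
    by (simp add: power2_eq_square mult_ac)
  then have "(norm (P x))\<^sup>2 \<le> K * Re (cinner x (P x))"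
    by (rule positive_op_norm_sq_le [OF bounded_clinear_clinear [OF P] pos _ \<open>0 < K\<close>])
  then show ?thesis
    by (simp add: 0)
qed

text \<open>The scalar iteration with \<open>s = 1\<close> increases to \<open>1\<close> and majorises the operator iteration
  termwise, so the latter converges in norm even though \<open>\<parallel>S\<parallel> = 1\<close> is allowed. Its limit \<open>Z\<close>
  satisfies \<open>(1 - Z)\<^sup>2 = 1 - S\<close>.\<close>
primrec sqrt_iter :: "('a::real_normed_vector \<Rightarrow>\<^sub>L 'a) \<Rightarrow> nat \<Rightarrow> ('a \<Rightarrow>\<^sub>L 'a)" where
  "sqrt_iter S 0 = 0"
| "sqrt_iter S (Suc n) = (1/2) *\<^sub>R (S + (sqrt_iter S n o\<^sub>L sqrt_iter S n))"

primrec sqrt_majorant :: "nat \<Rightarrow> real" where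
  "sqrt_majorant 0 = 0"
| "sqrt_majorant (Suc n) = (1 + (sqrt_majorant n)\<^sup>2) / 2"

lemma sqrt_majorant_bounds: "0 \<le> sqrt_majorant n" "sqrt_majorant n \<le> 1"
proof (induction n)
  case (Suc n)
  { case 1 show ?case by simp }
  { case 2 show ?case using Suc by (simp add: power_le_one) }
qed auto

lemma sqrt_majorant_mono: "sqrt_majorant n \<le> sqrt_majorant (Suc n)"
proof -
  have "0 \<le> (1 - sqrt_majorant n)\<^sup>2"
    by simp
  then show ?thesis
    by (simp add: power2_diff)
qed

text \<open>Every iterate is a polynomial in \<open>S\<close>. In the limit this shows that the
  square root commutes with whatever commutes with the original operator.\<close>

lemma sqrt_iter_commute:
  assumes "Q o\<^sub>L S = S o\<^sub>L Q"
  shows "Q o\<^sub>L sqrt_iter S n = sqrt_iter S n o\<^sub>L Q"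
proof (induction n)
  case 0
  show ?case by (simp add: blinfun_eqI blinfun.bilinear_simps)
next
  case (Suc n)
  have S: "Q (S x) = S (Q x)" for x
    using assms by (metis blinfun_apply_blinfun_compose)
  have IH: "Q (sqrt_iter S n x) = sqrt_iter S n (Q x)" for x
    using Suc by (metis blinfun_apply_blinfun_compose)
  show ?case
    by (rule blinfun_eqI) (simp add: blinfun.bilinear_simps S IH)
qed

lemma sqrt_iter_commute_iter:
  "sqrt_iter S m (sqrt_iter S n x) = sqrt_iter S n (sqrt_iter S m x)"
proof -
  have "sqrt_iter S m o\<^sub>L S = S o\<^sub>L sqrt_iter S m"
    by (rule sqrt_iter_commute [OF refl, symmetric])
  then have "sqrt_iter S m o\<^sub>L sqrt_iter S n = sqrt_iter S n o\<^sub>L sqrt_iter S m"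
    by (rule sqrt_iter_commute)
  then show ?thesis
    by (metis blinfun_apply_blinfun_compose)
qed

lemma norm_sqrt_iter_le:
  assumes "norm S \<le> 1"
  shows "norm (sqrt_iter S n) \<le> sqrt_majorant n"
proof (induction n)
  case (Suc n)
  have "norm (sqrt_iter S n o\<^sub>L sqrt_iter S n) \<le> norm (sqrt_iter S n) * norm (sqrt_iter S n)"
    by (rule norm_blinfun_compose)
  also have "\<dots> \<le> (sqrt_majorant n)\<^sup>2"
    unfolding power2_eq_square using Suc sqrt_majorant_bounds by (intro mult_mono) auto
  finally show ?case
    using assms norm_triangle_ineq [of S "sqrt_iter S n o\<^sub>L sqrt_iter S n"] by simp
qed simp

text \<open>A difference of squares factors because the iterates commute. The scalar sequence
  satisfies the same recursion for its increments, so the bound propagates.\<close>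

lemma norm_sqrt_iter_Suc_diff_le:
  assumes "norm S \<le> 1"
  shows "norm (sqrt_iter S (Suc n) - sqrt_iter S n) \<le> sqrt_majorant (Suc n) - sqrt_majorant n"
proof (induction n)
  case 0
  then show ?case
    using assms norm_sqrt_iter_le [OF assms, of 1] by simp
next
  case (Suc n)
  let ?D = "sqrt_iter S (Suc n) - sqrt_iter S n" and ?A = "sqrt_iter S (Suc n) + sqrt_iter S n"
  have "sqrt_iter S (Suc (Suc n)) - sqrt_iter S (Suc n) =
      (1/2) *\<^sub>R (S + (sqrt_iter S (Suc n) o\<^sub>L sqrt_iter S (Suc n)))
      - (1/2) *\<^sub>R (S + (sqrt_iter S n o\<^sub>L sqrt_iter S n))"
    by (intro arg_cong2 [where f = "(-)"] sqrt_iter.simps(2))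
  also have "\<dots> = (1/2) *\<^sub>R (?D o\<^sub>L ?A)"
    by (rule blinfun_eqI)
      (simp add: blinfun.bilinear_simps sqrt_iter_commute_iter [of S "Suc n" n]
        scaleR_diff_right scaleR_add_right del: sqrt_iter.simps)
  finally have "sqrt_iter S (Suc (Suc n)) - sqrt_iter S (Suc n) = (1/2) *\<^sub>R (?D o\<^sub>L ?A)" .
  then have "norm (sqrt_iter S (Suc (Suc n)) - sqrt_iter S (Suc n)) = norm (?D o\<^sub>L ?A) / 2"
    by (simp del: sqrt_iter.simps)
  also have "norm (?D o\<^sub>L ?A) \<le> norm ?D * norm ?A"
    by (rule norm_blinfun_compose)
  also have "\<dots> \<le> (sqrt_majorant (Suc n) - sqrt_majorant n) * (sqrt_majorant (Suc n) + sqrt_majorant n)"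
  proof (rule mult_mono)
    show "norm ?A \<le> sqrt_majorant (Suc n) + sqrt_majorant n"
      by (intro norm_triangle_le add_mono norm_sqrt_iter_le assms)
    show "0 \<le> sqrt_majorant (Suc n) - sqrt_majorant n"
      using sqrt_majorant_mono [of n] by simp
  qed (use Suc in auto)
  also have "\<dots> = (sqrt_majorant (Suc n))\<^sup>2 - (sqrt_majorant n)\<^sup>2"
    by (simp add: power2_eq_square algebra_simps del: sqrt_majorant.simps)
  also have "\<dots> / 2 = sqrt_majorant (Suc (Suc n)) - sqrt_majorant (Suc n)"
    unfolding sqrt_majorant.simps(2) [of "Suc n"] by (simp add: field_simps)
  finally show ?case
    by simp
qed

text \<open>The increment bounds telescope, so the iterates inherit the Cauchy property of the
  bounded increasing sequence \<open>sqrt_majorant\<close>.\<close>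

lemma sqrt_iter_convergent:
  fixes S :: "'a::banach \<Rightarrow>\<^sub>L 'a"
  assumes "norm S \<le> 1"
  shows "convergent (sqrt_iter S)"
proof -
  have inc: "incseq sqrt_majorant"
    using sqrt_majorant_mono by (rule incseq_SucI)
  have diff: "norm (sqrt_iter S m - sqrt_iter S n) \<le> sqrt_majorant m - sqrt_majorant n"
    if "n \<le> m" for m n
    using that
  proof (induction m rule: dec_induct)
    case (step m)
    then show ?case
      using norm_sqrt_iter_Suc_diff_le [OF assms, of m]
        norm_triangle_ineq [of "sqrt_iter S (Suc m) - sqrt_iter S m" "sqrt_iter S m - sqrt_iter S n"]
      by (simp del: sqrt_iter.simps sqrt_majorant.simps)
  qed simp
  have "Cauchy sqrt_majorant"
    using incseq_convergent [OF inc] sqrt_majorant_bounds(2)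
    by (metis LIMSEQ_imp_Cauchy)
  have "Cauchy (sqrt_iter S)"
  proof (rule CauchyI')
    fix e :: real
    assume "0 < e"
    then obtain M where M: "\<And>m n. M \<le> m \<Longrightarrow> M \<le> n \<Longrightarrow> \<bar>sqrt_majorant m - sqrt_majorant n\<bar> < e"
      using CauchyD [OF \<open>Cauchy sqrt_majorant\<close> \<open>0 < e\<close>] by auto
    have "norm (sqrt_iter S m - sqrt_iter S n) < e" if "M \<le> m" "m < n" for m n
      using diff [of m n] M [of n m] that by (simp add: norm_minus_commute)
    then show "\<exists>M. \<forall>m\<ge>M. \<forall>n>m. dist (sqrt_iter S m) (sqrt_iter S n) < e"
      unfolding dist_norm by blast
  qed
  then show ?thesis
    by (simp add: Cauchy_convergent_iff)
qed

text \<open>The iteration is run on the identity minus \<open>T\<close>. The commutation clause is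
  exported because \<open>positive_sqrt_unique\<close> compares commuting roots only.\<close>

lemma positive_contraction_sqrt:
  fixes T :: "'a::chilbert_space \<Rightarrow> 'a"
  assumes T: "bounded_clinear T" and pos: "positive_op T"
    and le: "\<And>x. Re (cinner x (T x)) \<le> (norm x)\<^sup>2"
  obtains P where "bounded_clinear P" "positive_op P" "\<And>x. P (P x) = T x"
    "\<forall>Q. bounded_linear Q \<and> (\<forall>x. Q (T x) = T (Q x)) \<longrightarrow> (\<forall>x. Q (P x) = P (Q x))"
proof -
  have linT: "clinear T"
    using T by (rule bounded_clinear_clinear)
  have linS: "clinear (\<lambda>x. x - T x)"
    by (simp add: scaleC_diff_right clinear_def clinearD [OF linT])
  have blS: "bounded_linear (\<lambda>x. x - T x)"
    by (intro bounded_linear_intros bounded_clinear_bounded_linear T)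
  have posS: "positive_op (\<lambda>x. x - T x)"
    using pos le by (simp add: positive_op_def cinner.diff_right cinner_self del: of_real_power)
  define S where "S = Blinfun (\<lambda>x. x - T x)"
  have S: "blinfun_apply S x = x - T x" for x
    unfolding S_def using blS by (simp add: bounded_linear_Blinfun_apply)
  have leS: "Re (cinner x (x - T x)) \<le> 1 * (norm x)\<^sup>2" for x
    using pos by (simp add: positive_op_def cinner.diff_right cinner_self del: of_real_power)
  \<comment> \<open>The form of \<open>S\<close> lies between 0 and the squared norm;
    \<open>positive_op_norm_sq_le\<close> with constant 1 upgrades this to a norm bound.\<close>
  have "norm S \<le> 1"
  proof (rule norm_blinfun_bound)
    show "norm (S x) \<le> 1 * norm x" for x
    proof -
      have "(norm (S x))\<^sup>2 \<le> 1 * Re (cinner x (S x))"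
        using positive_op_norm_sq_le [OF linS posS leS] by (simp add: S)
      also have "\<dots> \<le> (norm x)\<^sup>2"
        using leS by (simp add: S)
      finally show ?thesis
        by simp
    qed
  qed simp
  then obtain Z where Z: "sqrt_iter S \<longlonglongrightarrow> Z"
    using sqrt_iter_convergent by (auto simp: convergent_def)
  have Zx: "(\<lambda>n. sqrt_iter S n x) \<longlonglongrightarrow> Z x" for x
    by (intro tendsto_intros Z)
  have fix_eq: "Z = (1/2) *\<^sub>R (S + (Z o\<^sub>L Z))"
  proof (rule LIMSEQ_unique)
    show "(\<lambda>n. sqrt_iter S (Suc n)) \<longlonglongrightarrow> Z"
      using Z by (rule LIMSEQ_Suc)
    show "(\<lambda>n. sqrt_iter S (Suc n)) \<longlonglongrightarrow> (1/2) *\<^sub>R (S + (Z o\<^sub>L Z))"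
      unfolding sqrt_iter.simps
      by (intro tendsto_intros bounded_bilinear.tendsto [OF bounded_bilinear_blinfun_compose] Z)
  qed
  have normZ: "norm Z \<le> 1"
  proof (rule Lim_bounded)
    show "(\<lambda>n. norm (sqrt_iter S n)) \<longlonglongrightarrow> norm Z"
      by (intro tendsto_intros Z)
    show "\<forall>n\<ge>0. norm (sqrt_iter S n) \<le> 1"
      using norm_sqrt_iter_le [OF \<open>norm S \<le> 1\<close>] sqrt_majorant_bounds(2) order_trans by blast
  qed
  have commZ: "Q (Z x) = Z (Q x)" if Q: "bounded_linear Q" and "\<And>x. Q (T x) = T (Q x)" for Q x
  proof (rule LIMSEQ_unique)
    show "(\<lambda>n. Q (sqrt_iter S n x)) \<longlonglongrightarrow> Q (Z x)"
      by (intro bounded_linear.tendsto [OF Q] Zx)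
    have "Blinfun Q o\<^sub>L S = S o\<^sub>L Blinfun Q"
      by (rule blinfun_eqI)
        (simp add: bounded_linear_Blinfun_apply Q S that linear_diff bounded_linear.linear)
    then have "Blinfun Q o\<^sub>L sqrt_iter S n = sqrt_iter S n o\<^sub>L Blinfun Q" for n
      by (rule sqrt_iter_commute)
    then have "sqrt_iter S n (Q x) = Q (sqrt_iter S n x)" for n
      by (metis Q blinfun_apply_blinfun_compose bounded_linear_Blinfun_apply)
    then show "(\<lambda>n. Q (sqrt_iter S n x)) \<longlonglongrightarrow> Z (Q x)"
      using Zx [of "Q x"] by simp
  qed
  \<comment> \<open>Elements of the \<open>blinfun\<close> type are only real linear. Multiplication
    by a complex scalar is a bounded real-linear map commuting with \<open>T\<close>, so complex
    homogeneity is an instance of \<open>commZ\<close>.\<close>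
  have linZ: "clinear Z"
    using commZ [OF bounded_linear_scaleC]
    by (simp add: clinear_def blinfun.add_right clinear_scaleC [OF linT])
  have symS: "cinner (S x) y = cinner x (S y)" for x y
    unfolding S by (rule positive_op_symmetric [OF linS posS])
  have "cinner (sqrt_iter S n x) y = cinner x (sqrt_iter S n y)" for n x y
    by (induction n arbitrary: x y)
      (simp_all add: blinfun.bilinear_simps cinner_scaleR_left cinner_scaleR_right cinner_add_left
        cinner_add_right symS cinner.zero_left cinner.zero_right)
  then have "(\<lambda>n. cinner x (sqrt_iter S n y)) \<longlonglongrightarrow> cinner (Z x) y" for x y
    using cinner.tendsto [OF Zx [of x] tendsto_const [of y]] by simp
  then have symZ: "cinner (Z x) y = cinner x (Z y)" for x y
    by (rule LIMSEQ_unique) (rule cinner.tendsto [OF tendsto_const Zx])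
  define P where "P x = x - Z x" for x
  show thesis
  proof
    show "bounded_clinear P"
      unfolding bounded_clinear_iff
    proof
      show "clinear P"
        by (simp add: scaleC_diff_right clinear_def P_def clinearD [OF linZ])
      show "bounded_linear P"
        unfolding P_def by (intro bounded_linear_intros)
    qed
    show "positive_op P"
      unfolding positive_op_def
    proof
      fix x
      have "Im (cinner x (Z x)) = 0"
        using symZ [of x x] cinner_conj_sym [of x "Z x"] by (metis Reals_cnj_iff complex_is_Real_iff)
      moreover have "Re (cinner x (Z x)) \<le> (norm x)\<^sup>2"
      proof -
        have "norm (Z x) \<le> norm x"
          using norm_blinfun [of Z x] normZ mult_right_mono [OF normZ norm_ge_zero [of x]] by simp
        then show ?thesis
          using Re_cinner_le [of x "Z x"] mult_left_mono [of "norm (Z x)" "norm x" "norm x"]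
          by (simp add: power2_eq_square)
      qed
      ultimately show "Im (cinner x (P x)) = 0 \<and> 0 \<le> Re (cinner x (P x))"
        by (simp add: P_def cinner.diff_right cinner_self del: of_real_power)
    qed
    show "P (P x) = T x" for x
    proof -
      have "2 *\<^sub>R Z x = S x + Z (Z x)"
        by (subst fix_eq) (simp add: blinfun.bilinear_simps)
      then show ?thesis
        by (simp add: P_def S blinfun.diff_right scaleR_2 algebra_simps)
    qed
    show "\<forall>Q. bounded_linear Q \<and> (\<forall>x. Q (T x) = T (Q x)) \<longrightarrow> (\<forall>x. Q (P x) = P (Q x))"
      using commZ by (simp add: P_def linear_diff bounded_linear.linear)
  qed
qed

lemma positive_op_scaleR:
  assumes P: "bounded_clinear P" "positive_op P" and "0 \<le> r"
  shows "bounded_clinear (\<lambda>x. r *\<^sub>R P x)" "positive_op (\<lambda>x. r *\<^sub>R P x)"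
proof -
  show "bounded_clinear (\<lambda>x. r *\<^sub>R P x)"
    using P(1) unfolding bounded_clinear_iff
    by (auto simp: clinear_def scaleR_scaleC scaleC_add_right scaleC_scaleC mult.commute
        intro: bounded_linear_compose [OF bounded_linear_scaleC])
  show "positive_op (\<lambda>x. r *\<^sub>R P x)"
    using P(2) \<open>0 \<le> r\<close> by (simp add: positive_op_def cinner_scaleR_right)
qed

lemma positive_sqrt_exists:
  fixes T :: "'a::chilbert_space \<Rightarrow> 'a"
  assumes T: "bounded_clinear T" and pos: "positive_op T"
  obtains P where "bounded_clinear P" "positive_op P" "\<And>x. P (P x) = T x"
    "\<forall>Q. bounded_linear Q \<and> (\<forall>x. Q (T x) = T (Q x)) \<longrightarrow> (\<forall>x. Q (P x) = P (Q x))"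
proof -
  obtain K where "0 < K" and K: "\<And>x. norm (T x) \<le> norm x * K"
    using bounded_linear.pos_bounded [OF bounded_clinear_bounded_linear [OF T]] by blast
  \<comment> \<open>Scaling by \<open>c\<close> makes \<open>T\<close> a contraction; the root found
    for it is scaled back by \<open>sqrt K\<close>.\<close>
  define c where "c = inverse K"
  have "0 \<le> c"
    using \<open>0 < K\<close> by (simp add: c_def)
  have le: "Re (cinner x (c *\<^sub>R T x)) \<le> (norm x)\<^sup>2" for x
  proof -
    have "c * Re (cinner x (T x)) \<le> c * (norm x * (norm x * K))"
      using Re_cinner_le [of x "T x"] mult_left_mono [OF K [of x] norm_ge_zero [of x]] \<open>0 \<le> c\<close>
      by (intro mult_left_mono) auto
    then show ?thesis
      using \<open>0 < K\<close> by (simp add: c_def cinner_scaleR_right power2_eq_square field_simps)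
  qed
  obtain R where R: "bounded_clinear R" "positive_op R" and sq: "\<And>x. R (R x) = c *\<^sub>R T x"
    and comm: "\<forall>Q. bounded_linear Q \<and> (\<forall>x. Q (c *\<^sub>R T x) = c *\<^sub>R T (Q x)) \<longrightarrow>
      (\<forall>x. Q (R x) = R (Q x))"
    by (rule positive_contraction_sqrt [OF positive_op_scaleR [OF T pos \<open>0 \<le> c\<close>] le]) blast
  show thesis
  proof
    show "bounded_clinear (\<lambda>x. sqrt K *\<^sub>R R x)" "positive_op (\<lambda>x. sqrt K *\<^sub>R R x)"
      using \<open>0 < K\<close> by (auto intro!: positive_op_scaleR R)
    show "sqrt K *\<^sub>R R (sqrt K *\<^sub>R R x) = T x" for x
      using \<open>0 < K\<close> R(1)
      by (simp add: linear_scale clinear_imp_linear bounded_clinear_clinear sq c_def flip: mult.assoc)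
    show "\<forall>Q. bounded_linear Q \<and> (\<forall>x. Q (T x) = T (Q x)) \<longrightarrow>
        (\<forall>x. Q (sqrt K *\<^sub>R R x) = sqrt K *\<^sub>R R (Q x))"
      using comm by (simp add: linear_scale bounded_linear.linear)
  qed
qed

text \<open>For \<open>y = P x - Q x\<close>, commutation gives \<open>P y + Q y = 0\<close>. Both
  forms are nonnegative and hence vanish at \<open>y\<close>, so \<open>P y = Q y = 0\<close>, and
  symmetry moves \<open>P - Q\<close> across to get \<open>cinner y y = 0\<close>.\<close>

lemma positive_sqrt_unique:
  fixes P Q :: "'a::complex_inner \<Rightarrow> 'a"
  assumes P: "bounded_clinear P" "positive_op P" and Q: "bounded_clinear Q" "positive_op Q"
    and sq: "\<And>x. P (P x) = Q (Q x)" and comm: "\<And>x. Q (P x) = P (Q x)"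
  shows "P x = Q x"
proof -
  note lin = bounded_clinear_clinear [OF P(1)] bounded_clinear_clinear [OF Q(1)]
  define y where "y = P x - Q x"
  have "P y + Q y = 0"
    by (simp add: y_def clinear_diff lin sq comm)
  then have "Re (cinner y (P y)) + Re (cinner y (Q y)) = 0"
    by (metis cinner_add_right cinner.zero_right plus_complex.sel(1) zero_complex.sel(1))
  then have "Re (cinner y (P y)) = 0" "Re (cinner y (Q y)) = 0"
    using P(2) Q(2) by (smt (verit) positive_op_def)+
  then have "P y = 0" "Q y = 0"
    using positive_op_eq_0 P Q by blast+
  then have "cinner y y = 0"
    by (subst y_def)
      (simp add: cinner.diff_left positive_op_symmetric P(2) Q(2) lin cinner.zero_right)
  then show ?thesis
    by (simp add: cinner_self_eq_zero y_def)
qed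

section \<open>The modulus of an operator\<close>

lemma positive_adj_self:
  fixes A :: "'a::chilbert_space \<Rightarrow> 'b::chilbert_space"
  assumes A: "bounded_clinear A"
  shows "positive_op (\<lambda>x. adj A (A x))"
  unfolding positive_op_def cinner_adj [OF A, symmetric] by (simp add: cinner_self del: of_real_power)

text \<open>Any competing root \<open>Q\<close> commutes with its own square
  \<open>adj A (A x)\<close>, hence with the constructed root \<open>P\<close>, and uniqueness for
  commuting roots applies.\<close>

lemma absop_ex1:
  fixes A :: "'a::chilbert_space \<Rightarrow> 'b::chilbert_space"
  assumes A: "bounded_clinear A"
  shows "\<exists>!P. bounded_clinear P \<and> positive_op P \<and> (\<forall>x. P (P x) = adj A (A x))"
proof -
  have "bounded_clinear (\<lambda>x. adj A (A x))"
    by (rule bounded_clinear_compose [OF bounded_clinear_adj [OF A] A])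
  then obtain P where P: "bounded_clinear P" "positive_op P" and sq: "\<And>x. P (P x) = adj A (A x)"
    and comm: "\<forall>Q. bounded_linear Q \<and> (\<forall>x. Q (adj A (A x)) = adj A (A (Q x))) \<longrightarrow>
      (\<forall>x. Q (P x) = P (Q x))"
    by (rule positive_sqrt_exists [OF _ positive_adj_self [OF A]]) blast
  show ?thesis
  proof (intro ex1I conjI allI)
    show "Q = P" if Q: "bounded_clinear Q \<and> positive_op Q \<and> (\<forall>x. Q (Q x) = adj A (A x))" for Q
    proof (rule ext, rule positive_sqrt_unique [where P = P and Q = Q, symmetric])
      show "Q (P x) = P (Q x)" for x
        using Q comm by (metis bounded_clinear_bounded_linear)
    qed (use P Q sq in auto)
  qed (use P sq in auto)
qed

lemma absop:
  fixes A :: "'a::chilbert_space \<Rightarrow> 'b::chilbert_space"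
  assumes A: "bounded_clinear A"
  shows bounded_clinear_absop: "bounded_clinear (absop A)"
    and positive_absop: "positive_op (absop A)"
    and absop_square: "absop A (absop A x) = adj A (A x)"
  using theI' [OF absop_ex1 [OF A]] by (auto simp: absop_def)

lemma absop_eqI:
  fixes A :: "'a::chilbert_space \<Rightarrow> 'b::chilbert_space"
  assumes "bounded_clinear A" "bounded_clinear P" "positive_op P" "\<And>x. P (P x) = adj A (A x)"
  shows "absop A = P"
  unfolding absop_def by (rule the1_equality [OF absop_ex1]) (use assms in auto)

text \<open>The isometry behind polar decomposition. It turns an intertwining of moduli into an
  equality of norms of the weights.\<close>

lemma norm_absop:
  fixes A :: "'a::chilbert_space \<Rightarrow> 'b::chilbert_space"
  assumes A: "bounded_clinear A"
  shows "norm (absop A x) = norm (A x)"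
proof -
  have "cinner (absop A x) (absop A x) = cinner x (adj A (A x))"
    by (simp add: positive_op_symmetric bounded_clinear_clinear bounded_clinear_absop
        positive_absop absop_square A)
  also have "\<dots> = cinner (A x) (A x)"
    by (simp add: cinner_adj A)
  finally show ?thesis
    by (simp add: norm_eq_sqrt_cinner)
qed

section \<open>Extending isometries from a dense range\<close>

lemma eq_on_dense:
  fixes f g :: "'a::topological_space \<Rightarrow> 'b::t2_space"
  assumes "continuous_on UNIV f" "continuous_on UNIV g"
    and "closure (range h) = UNIV" and "\<And>z. f (h z) = g (h z)"
  shows "f x = g x"
proof -
  have "closed {x. f x = g x}"
    using assms by (intro closed_Collect_eq)
  then have "closure (range h) \<subseteq> {x. f x = g x}"
    using assms(4) by (intro closure_minimal) auto
  then show ?thesis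
    using assms(3) by blast
qed

lemma isometry_extension:
  fixes A :: "'c::complex_inner \<Rightarrow> 'a::complex_inner" and B :: "'c \<Rightarrow> 'b::chilbert_space"
  assumes A: "clinear A" and B: "clinear B"
    and norm_eq: "\<And>x. norm (A x) = norm (B x)"
    and dense: "closure (range A) = UNIV"
  obtains U where "clinear U" "\<And>y. norm (U y) = norm y" "\<And>x. U (A x) = B x"
proof -
  have dist_eq: "dist (A x) (A y) = dist (B x) (B y)" for x y
    using norm_eq [of "x - y"] by (simp add: dist_norm clinear_diff A B)
  \<comment> \<open>\<open>inv A\<close> picks some preimage; by \<open>dist_eq\<close> the value of
    \<open>B\<close> does not depend on the choice.\<close>
  define f where "f y = B (inv A y)" for y
  have f: "f (A x) = B x" for x
  proof -
    have "A (inv A (A x)) = A x"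
      by (rule f_inv_into_f) simp
    then have "dist (B (inv A (A x))) (B x) = 0"
      using dist_eq [of "inv A (A x)" x] by simp
    then show ?thesis
      by (simp add: f_def)
  qed
  have "uniformly_continuous_on (range A) f"
    unfolding uniformly_continuous_on_def by (auto simp: f dist_eq)
  then obtain U where "uniformly_continuous_on (closure (range A)) U"
    and fU: "\<And>x. x \<in> range A \<Longrightarrow> f x = U x"
    by (rule uniformly_continuous_on_extension_on_closure) blast
  then have contU: "continuous_on UNIV U"
    using dense uniformly_continuous_imp_continuous by metis
  have U: "U (A x) = B x" for x
    using fU [of "A x"] by (simp add: f)
  have contU_add: "continuous_on UNIV (\<lambda>z. U (c + z))" for c
    by (intro continuous_on_compose2 [OF contU] continuous_intros) auto
  \<comment> \<open>Stated at a fresh type \<open>'d\<close>, since it is used both in the domain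
    and in the codomain of \<open>U\<close>.\<close>
  have contC: "continuous_on UNIV (\<lambda>x :: 'd :: complex_inner. scaleC c x)" for c
    by (rule linear_continuous_on [OF bounded_linear_scaleC])
  \<comment> \<open>Additivity is obtained by two density arguments, one for each summand; here the
    first summand still lies in the range of \<open>A\<close>.\<close>
  have add1: "U (A x + z) = U (A x) + U z" for x z
  proof (rule eq_on_dense [OF contU_add _ dense])
    show "continuous_on UNIV (\<lambda>z. U (A x) + U z)"
      by (intro continuous_intros contU)
    show "U (A x + A y) = U (A x) + U (A y)" for y
      by (simp add: U clinear_add [OF B] flip: clinear_add [OF A])
  qed
  have "U (z + y) = U z + U y" for y z
  proof (rule eq_on_dense [of "\<lambda>y. U (z + y)", OF contU_add _ dense])
    show "continuous_on UNIV (\<lambda>y. U z + U y)"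
      by (intro continuous_intros contU)
    show "U (z + A x) = U z + U (A x)" for x
      using add1 [of x z] by (simp add: add.commute)
  qed
  moreover have "U (scaleC c y) = scaleC c (U y)" for c y
  proof (rule eq_on_dense [OF _ _ dense])
    show "continuous_on UNIV (\<lambda>y. U (scaleC c y))"
      by (intro continuous_on_compose2 [OF contU contC]) auto
    show "continuous_on UNIV (\<lambda>y. scaleC c (U y))"
      by (intro continuous_on_compose2 [OF contC contU]) auto
    show "U (scaleC c (A x)) = scaleC c (U (A x))" for x
      by (simp add: U clinear_scaleC [OF B] flip: clinear_scaleC [OF A])
  qed
  ultimately have "clinear U"
    by (simp add: clinear_def)
  moreover have "norm (U y) = norm y" for y
    by (rule eq_on_dense [OF _ _ dense]) (auto intro!: continuous_on_norm contU simp: U norm_eq)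
  ultimately show thesis
    using U that by blast
qed

text \<open>With both ranges dense the extension can be made in either direction, and the two
  extensions invert each other on dense sets, hence everywhere.\<close>

lemma unitary_extension:
  fixes A :: "'c::complex_inner \<Rightarrow> 'a::chilbert_space" and B :: "'c \<Rightarrow> 'b::chilbert_space"
  assumes A: "clinear A" and B: "clinear B"
    and norm_eq: "\<And>x. norm (A x) = norm (B x)"
    and dA: "closure (range A) = UNIV" and dB: "closure (range B) = UNIV"
  obtains U where "unitary_iso U" "\<And>x. U (A x) = B x"
proof -
  obtain U where U: "clinear U" "\<And>y. norm (U y) = norm y" "\<And>x. U (A x) = B x"
    using isometry_extension [OF A B norm_eq dA] by blast
  obtain V where V: "clinear V" "\<And>y. norm (V y) = norm y" "\<And>x. V (B x) = A x"
    using isometry_extension [OF B A norm_eq [symmetric] dB] by blast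
  have cont: "continuous_on UNIV (\<lambda>x. V (U x))" "continuous_on UNIV (\<lambda>x. U (V x))"
    using U V by (auto simp: clinear_def intro!: linear_continuous_on bounded_clinear_bounded_linear
        bounded_clinearI [where K = 1])
  have "V (U y) = y" for y
    by (rule eq_on_dense [OF cont(1) continuous_on_id dA]) (simp add: U V)
  moreover have "U (V y) = y" for y
    by (rule eq_on_dense [OF cont(2) continuous_on_id dB]) (simp add: U V)
  ultimately have "bij U"
    by (intro o_bij [of V]) auto
  then show thesis
    using U that by (blast intro: unitary_isoI)
qed

section \<open>The sequence space\<close>

definition l2single :: "nat \<Rightarrow> 'a::complex_inner \<Rightarrow> nat \<Rightarrow> 'a" where
  "l2single n x = (\<lambda>k. if k = n then x else 0)"

lemma l2seq_iff_summable: "h \<in> l2seq \<longleftrightarrow> summable (\<lambda>n. (norm (h n))\<^sup>2)"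
  by (simp add: l2seq_def)

lemma l2norm_sq: "h \<in> l2seq \<Longrightarrow> (l2norm h)\<^sup>2 = (\<Sum>n. (norm (h n))\<^sup>2)"
  by (simp add: l2norm_def l2seq_def suminf_nonneg)

lemma l2seq_add:
  assumes "h \<in> l2seq" "g \<in> l2seq"
  shows "(\<lambda>n. h n + g n) \<in> l2seq"
proof -
  have le: "(norm (x + y))\<^sup>2 \<le> 2 * (norm x)\<^sup>2 + 2 * (norm y)\<^sup>2" for x y :: 'a
    using norm_add_sq [of x y] norm_add_sq [of x "- y"] zero_le_power2 [of "norm (x - y)"]
    by (simp add: cinner.minus_right)
  have "summable (\<lambda>n. 2 * (norm (h n))\<^sup>2 + 2 * (norm (g n))\<^sup>2)"
    using assms by (intro summable_add summable_mult) (auto simp: l2seq_iff_summable)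
  then show ?thesis
    unfolding l2seq_iff_summable
    by (rule summable_comparison_test_ev [rotated]) (simp add: le)
qed

lemma l2seq_scaleC: "h \<in> l2seq \<Longrightarrow> (\<lambda>n. scaleC c (h n)) \<in> l2seq"
  by (simp add: l2seq_iff_summable norm_scaleC power_mult_distrib summable_mult)

lemma l2single_sums: "(\<lambda>k. (norm (l2single n x k))\<^sup>2) sums (norm x)\<^sup>2"
proof -
  have "(\<lambda>k. (norm (l2single n x k))\<^sup>2) = (\<lambda>k. if k = n then (norm x)\<^sup>2 else 0)"
    by (auto simp: l2single_def)
  then show ?thesis
    using sums_single [of n "\<lambda>_. (norm x)\<^sup>2"] by simp
qed

lemma l2single_in_l2seq [simp]: "l2single n x \<in> l2seq"
  using l2single_sums sums_summable by (auto simp: l2seq_iff_summable)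

lemma l2norm_l2single [simp]: "l2norm (l2single n x) = norm x"
  by (simp add: l2norm_def flip: sums_unique [OF l2single_sums])

lemma l2single_add: "l2single n (x + y) = (\<lambda>k. l2single n x k + l2single n y k)"
  and l2single_scaleC: "l2single n (scaleC c x) = (\<lambda>k. scaleC c (l2single n x k))"
  by (auto simp: l2single_def)

lemma l2single_same [simp]: "l2single n x n = x"
  by (simp add: l2single_def)

text \<open>Only coordinate \<open>n\<close> of the sum changes. This does the work of an inner
  product on sequences when orthogonality is tested below.\<close>

lemma l2norm_sq_add_l2single:
  assumes h: "h \<in> l2seq"
  shows "(l2norm (\<lambda>k. h k + l2single n x k))\<^sup>2 = (l2norm h)\<^sup>2 - (norm (h n))\<^sup>2 + (norm (h n + x))\<^sup>2"
proof -
  have "(\<lambda>k. (norm (h k))\<^sup>2 + (if k = n then (norm (h k + x))\<^sup>2 - (norm (h k))\<^sup>2 else 0))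
      sums ((l2norm h)\<^sup>2 + ((norm (h n + x))\<^sup>2 - (norm (h n))\<^sup>2))"
    unfolding l2norm_sq [OF h] using h
    by (intro sums_add sums_single summable_sums) (simp add: l2seq_iff_summable)
  also have "(\<lambda>k. (norm (h k))\<^sup>2 + (if k = n then (norm (h k + x))\<^sup>2 - (norm (h k))\<^sup>2 else 0))
      = (\<lambda>k. (norm (h k + l2single n x k))\<^sup>2)"
    by (auto simp: l2single_def)
  finally show ?thesis
    using l2norm_sq [OF l2seq_add [OF h l2single_in_l2seq]] sums_unique by fastforce
qed

lemma norm_le_l2norm:
  assumes "h \<in> l2seq"
  shows "norm (h n) \<le> l2norm h"
proof -
  have "(norm (h n))\<^sup>2 \<le> (l2norm h)\<^sup>2"
    unfolding l2norm_sq [OF assms]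
    using sum_le_suminf [of "\<lambda>n. (norm (h n))\<^sup>2" "{n}"] assms by (simp add: l2seq_iff_summable)
  moreover have "0 \<le> l2norm h"
    using assms by (simp add: l2norm_def l2seq_def suminf_nonneg)
  ultimately show ?thesis
    by (rule power2_le_imp_le)
qed

lemma wshift_in_l2seq:
  assumes "weight_seq W" and h: "h \<in> l2seq"
  shows "wshift W h \<in> l2seq"
proof -
  obtain K where K: "\<And>n x. norm (W n x) \<le> K * norm x"
    using assms(1) by (auto simp: weight_seq_def)
  have "summable (\<lambda>n. K\<^sup>2 * (norm (h n))\<^sup>2)"
    using h by (simp add: l2seq_iff_summable summable_mult)
  then have "summable (\<lambda>n. (norm (W n (h n)))\<^sup>2)"
    by (rule summable_comparison_test_ev [rotated])
      (simp add: power_mono [OF K] flip: power_mult_distrib)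
  then have "summable (\<lambda>n. (norm (wshift W h (Suc n)))\<^sup>2)"
    by (simp add: wshift_def)
  then show ?thesis
    unfolding l2seq_iff_summable by (subst (asm) summable_Suc_iff)
qed

lemma wshift_l2single:
  assumes "\<And>m. clinear (W m)"
  shows "wshift W (l2single n x) = l2single (Suc n) (W n x)"
proof -
  have "W m 0 = 0" for m
    using assms by (simp add: clinear_imp_linear linear_0)
  then show ?thesis
    by (auto simp: wshift_def l2single_def fun_eq_iff)
qed

lemma l2_unitaryD:
  assumes U: "l2_unitary U"
  shows l2_unitary_bij: "bij_betw U l2seq l2seq"
    and l2_unitary_in: "h \<in> l2seq \<Longrightarrow> U h \<in> l2seq"
    and l2_unitary_add: "h \<in> l2seq \<Longrightarrow> g \<in> l2seq \<Longrightarrow> U (\<lambda>n. h n + g n) = (\<lambda>n. U h n + U g n)"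
    and l2_unitary_scaleC: "h \<in> l2seq \<Longrightarrow> U (\<lambda>n. scaleC c (h n)) = (\<lambda>n. scaleC c (U h n))"
    and l2_unitary_norm: "h \<in> l2seq \<Longrightarrow> l2norm (U h) = l2norm h"
  using U by (auto simp: l2_unitary_def bij_betw_def)

text \<open>\<open>U\<close> is a function on all sequences but is controlled only on
  \<open>l2seq\<close>; hence \<open>inv_into\<close> and cancellation laws restricted to that
  set.\<close>

lemma l2_unitary_inv:
  assumes U: "l2_unitary U"
  obtains V where "l2_unitary V" "\<And>h. h \<in> l2seq \<Longrightarrow> V (U h) = h" "\<And>h. h \<in> l2seq \<Longrightarrow> U (V h) = h"
proof -
  define V where "V = inv_into l2seq U"
  note bij = l2_unitary_bij [OF U]
  have VU: "V (U h) = h" if "h \<in> l2seq" for h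
    unfolding V_def using bij that by (simp add: bij_betw_def)
  have UV: "U (V h) = h" if "h \<in> l2seq" for h
    unfolding V_def using bij that by (simp add: bij_betw_inv_into_right)
  have bijV: "bij_betw V l2seq l2seq"
    unfolding V_def using bij by (rule bij_betw_inv_into)
  then have V: "V h \<in> l2seq" if "h \<in> l2seq" for h
    using that by (auto simp: bij_betw_def)
  have "l2_unitary V"
    unfolding l2_unitary_def
  proof (intro conjI ballI allI bijV)
    show "V (\<lambda>n. h n + g n) = (\<lambda>n. V h n + V g n)" if "h \<in> l2seq" "g \<in> l2seq" for h g
      using VU [OF l2seq_add [OF V V]] that by (simp add: l2_unitary_add [OF U] V UV)
    show "V (\<lambda>n. scaleC c (h n)) = (\<lambda>n. scaleC c (V h n))" if "h \<in> l2seq" for h c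
      using VU [OF l2seq_scaleC [OF V]] that by (simp add: l2_unitary_scaleC [OF U] V UV)
    show "l2norm (V h) = l2norm h" if "h \<in> l2seq" for h
      using l2_unitary_norm [OF U V] that by (simp add: UV)
  qed
  then show thesis
    using VU UV that by blast
qed

section \<open>Intertwining unitaries are diagonal\<close>

text \<open>Vectors supported at \<open>Suc n\<close> with entry in the range of \<open>W1 n\<close>
  are shifts of vectors supported at \<open>n\<close>, so their images are shifts too and start one
  place later. Density and continuity of each coordinate cover the remaining entries.\<close>

lemma intertwiner_lower_triangular:
  assumes U: "l2_unitary U" and W1: "weight_seq W1"
    and dense: "\<forall>n. closure (range (W1 n)) = UNIV"
    and int: "\<forall>h\<in>l2seq. U (wshift W1 h) = wshift W2 (U h)"
    and W2: "weight_seq W2"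
    and "j < n"
  shows "U (l2single n x) j = 0"
  using \<open>j < n\<close>
proof (induction n arbitrary: x j)
  case (Suc n)
  have W2_0: "W2 m 0 = 0" for m
    using W2 by (simp add: weight_seq_def bounded_clinear_clinear clinear_imp_linear linear_0)
  have bl: "bounded_linear (\<lambda>y. U (l2single (Suc n) y) j)"
  proof (rule bounded_linear_intro [where K = 1])
    show "norm (U (l2single (Suc n) y) j) \<le> norm y * 1" for y
      using norm_le_l2norm [OF l2_unitary_in [OF U l2single_in_l2seq], of "Suc n" y j]
      by (simp add: l2_unitary_norm [OF U])
  qed (simp_all add: scaleR_scaleC l2single_add l2single_scaleC l2_unitary_add [OF U]
      l2_unitary_scaleC [OF U])
  \<comment> \<open>Coordinate \<open>j\<close> of a shifted sequence is 0 for \<open>j = 0\<close>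
    and otherwise depends on coordinate \<open>j - 1 < n\<close>, which vanishes by
    induction.\<close>
  have range_0: "U (l2single (Suc n) (W1 n y)) j = 0" for y
  proof -
    have "U (l2single (Suc n) (W1 n y)) = wshift W2 (U (l2single n y))"
      using int wshift_l2single [of W1 n y] W1
      by (metis bounded_clinear_clinear l2single_in_l2seq weight_seq_def)
    then show ?thesis
      using Suc by (simp add: wshift_def W2_0)
  qed
  have "closure (range (W1 n)) = UNIV"
    using dense by blast
  then show ?case
    by (rule eq_on_dense [OF linear_continuous_on [OF bl] continuous_on_const _ range_0])
qed simp

text \<open>Compare \<open>\<parallel>U e + f\<parallel>\<close> with \<open>\<parallel>e + V f\<parallel>\<close> for \<open>e = l2single n x\<close> and
  \<open>f = l2single m y\<close>, where \<open>y\<close> is the \<open>m\<close>-th entry of \<open>U e\<close>.\<close>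
lemma triangular_unitary_diagonal:
  assumes U: "l2_unitary U" and V: "l2_unitary V"
    and UV: "\<And>h. h \<in> l2seq \<Longrightarrow> U (V h) = h"
    and triU: "\<And>n x j. j < n \<Longrightarrow> U (l2single n x) j = 0"
    and triV: "\<And>n x j. j < n \<Longrightarrow> V (l2single n x) j = 0"
  shows "U (l2single n x) = l2single n (U (l2single n x) n)"
proof
  fix m
  define h where "h = U (l2single n x)"
  have h: "h \<in> l2seq"
    by (simp add: h_def l2_unitary_in [OF U])
  have norm_h: "l2norm h = norm x"
    by (simp add: h_def l2_unitary_norm [OF U])
  consider "m < n" | "m = n" | "n < m"
    by linarith
  then have "h m = l2single n (h n) m"
  proof cases
    case 1
    then show ?thesis using triU [OF 1] by (simp add: h_def) (simp add: l2single_def)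
  next
    case 2
    then show ?thesis by simp
  next
    case 3
    define g where "g = V (l2single m (h m))"
    have g: "g \<in> l2seq" "l2norm g = norm (h m)" "U g = l2single m (h m)" "g n = 0"
      using 3 by (auto simp: g_def l2_unitary_in [OF V] l2_unitary_norm [OF V] UV triV)
    have "U (\<lambda>k. g k + l2single n x k) = (\<lambda>k. h k + l2single m (h m) k)"
      using g by (simp add: l2_unitary_add [OF U] h_def add.commute)
    then have "(l2norm (\<lambda>k. g k + l2single n x k))\<^sup>2 = (l2norm (\<lambda>k. h k + l2single m (h m) k))\<^sup>2"
      using l2_unitary_norm [OF U l2seq_add [OF g(1) l2single_in_l2seq]] by metis
    \<comment> \<open>On the left \<open>g n = 0\<close>, so the squares simply add. On the right
      the entry \<open>h m\<close> is doubled, which contributes three extra copies of its squared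
      norm; equality leaves only \<open>h m = 0\<close>.\<close>
    then have "(norm (h m))\<^sup>2 + (norm x)\<^sup>2 = (norm x)\<^sup>2 - (norm (h m))\<^sup>2 + (norm (h m + h m))\<^sup>2"
      by (simp add: l2norm_sq_add_l2single g h norm_h)
    then have "(norm (h m))\<^sup>2 = 0"
      by (simp add: norm_add_sq cinner_self del: of_real_power)
    then show ?thesis
      using 3 by (simp add: l2single_def)
  qed
  then show "U (l2single n x) m = l2single n (U (l2single n x) n) m"
    by (simp add: h_def)
qed

lemma intertwiner_diagonal:
  fixes W1 :: "nat \<Rightarrow> 'a::chilbert_space \<Rightarrow> 'a" and W2 :: "nat \<Rightarrow> 'b::chilbert_space \<Rightarrow> 'b"
  assumes "shift_unitarily_equiv W1 W2"
    and W1: "weight_seq W1" and W2: "weight_seq W2"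
    and dense1: "\<forall>n. closure (range (W1 n)) = UNIV"
    and dense2: "\<forall>n. closure (range (W2 n)) = UNIV"
  obtains D :: "nat \<Rightarrow> 'a \<Rightarrow> 'b" where "\<And>n. unitary_iso (D n)"
    "\<And>n x. D (Suc n) (W1 n x) = W2 n (D n x)"
proof -
  obtain U where U: "l2_unitary U" and int: "\<forall>h\<in>l2seq. U (wshift W1 h) = wshift W2 (U h)"
    using assms(1) by (auto simp: shift_unitarily_equiv_def)
  obtain V where V: "l2_unitary V" and VU: "\<And>h. h \<in> l2seq \<Longrightarrow> V (U h) = h"
    and UV: "\<And>h. h \<in> l2seq \<Longrightarrow> U (V h) = h"
    using l2_unitary_inv [OF U] by blast
  \<comment> \<open>The inverse intertwines in the opposite direction, so triangularity applies to
    it with the weights exchanged, now using density of the ranges of \<open>W2\<close>.\<close>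
  have intV: "\<forall>h\<in>l2seq. V (wshift W2 h) = wshift W1 (V h)"
  proof
    fix h :: "nat \<Rightarrow> 'b"
    assume h: "h \<in> l2seq"
    then have Vh: "V h \<in> l2seq"
      by (rule l2_unitary_in [OF V])
    then show "V (wshift W2 h) = wshift W1 (V h)"
      using VU [OF wshift_in_l2seq [OF W1 Vh]] int h by (simp add: UV)
  qed
  note triU = intertwiner_lower_triangular [OF U W1 dense1 int W2]
  note triV = intertwiner_lower_triangular [OF V W2 dense2 intV W1]
  note diagU = triangular_unitary_diagonal [OF U V UV triU triV]
  note diagV = triangular_unitary_diagonal [OF V U VU triV triU]
  define D where "D n x = U (l2single n x) n" for n x
  define E where "E n y = V (l2single n y) n" for n y
  have UD: "U (l2single n x) = l2single n (D n x)" for n x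
    unfolding D_def by (rule diagU)
  have VE: "V (l2single n y) = l2single n (E n y)" for n y
    unfolding E_def by (rule diagV)
  have "E n (D n x) = x" for n x
    using VU [of "l2single n x"] by (simp add: UD VE) (metis l2single_same)
  moreover have "D n (E n y) = y" for n y
    using UV [of "l2single n y"] by (simp add: UD VE) (metis l2single_same)
  ultimately have "bij (D n)" for n
    by (intro o_bij [of "E n"]) auto
  moreover have "clinear (D n)" for n
    by (simp add: clinear_def D_def l2single_add l2single_scaleC l2_unitary_add [OF U]
        l2_unitary_scaleC [OF U])
  moreover have "norm (D n x) = norm x" for n x
    using l2_unitary_norm [OF U l2single_in_l2seq [of n x]] by (simp add: UD)
  ultimately have "unitary_iso (D n)" for n
    by (intro unitary_isoI)
  moreover have "D (Suc n) (W1 n x) = W2 n (D n x)" for n x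
  proof -
    have lin: "clinear (W1 n)" "clinear (W2 n)" for n
      using W1 W2 by (auto simp: weight_seq_def bounded_clinear_clinear)
    have "l2single (Suc n) (D (Suc n) (W1 n x)) = U (wshift W1 (l2single n x))"
      by (simp add: wshift_l2single lin UD)
    also have "\<dots> = wshift W2 (l2single n (D n x))"
      using int by (simp add: UD)
    also have "\<dots> = l2single (Suc n) (W2 n (D n x))"
      by (simp add: wshift_l2single lin)
    finally show ?thesis
      by (metis l2single_same)
  qed
  ultimately show thesis
    by (rule that)
qed

lemma diagonal_shift_equiv:
  fixes D :: "nat \<Rightarrow> 'a::complex_inner \<Rightarrow> 'b::complex_inner"
  assumes D: "\<And>n. unitary_iso (D n)" and int: "\<And>n x. D (Suc n) (W1 n x) = W2 n (D n x)"
  shows "shift_unitarily_equiv W1 W2"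
proof -
  define U where "U h = (\<lambda>n. D n (h n))" for h
  note lin = unitary_isoD(1) [OF D]
  have norm: "norm (D n x) = norm x" for n x
    by (rule unitary_isoD(3) [OF D])
  have D_inv: "D n (inv (D n) y) = y" "inv (D n) (D n x) = x" for n x y
    using unitary_isoD(2) [OF D [of n]] by (simp_all add: bij_is_surj surj_f_inv_f bij_is_inj)
  have norm_inv: "norm (inv (D n) y) = norm y" for n y
    by (metis D_inv(1) norm)
  have "bij_betw U l2seq l2seq"
    by (rule bij_betw_byWitness [where f' = "\<lambda>h n. inv (D n) (h n)"])
      (auto simp: U_def D_inv l2seq_iff_summable norm norm_inv)
  then have "l2_unitary U"
    unfolding l2_unitary_def
    by (auto simp: U_def clinear_add [OF lin] clinear_scaleC [OF lin] l2norm_def norm)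
  moreover have "U (wshift W1 h) = wshift W2 (U h)" for h
  proof
    fix k
    have "D 0 0 = 0"
      using lin by (simp add: clinear_imp_linear linear_0)
    then show "U (wshift W1 h) k = wshift W2 (U h) k"
      by (cases k) (simp_all add: U_def wshift_def int)
  qed
  ultimately show ?thesis
    unfolding shift_unitarily_equiv_def by blast
qed

section \<open>Intertwining the moduli of the weights\<close>

text \<open>The outer unitary \<open>U'\<close> cancels in \<open>adj A (A x)\<close>, so
  conjugating \<open>absop B\<close> by \<open>U\<close> gives a positive square root of it, which
  must be \<open>absop A\<close>. It is applied with consecutive diagonal entries as
  \<open>U\<close> and \<open>U'\<close>.\<close>

lemma absop_unitary_intertwine:
  fixes A :: "'a::chilbert_space \<Rightarrow> 'c::chilbert_space" and B :: "'b::chilbert_space \<Rightarrow> 'd::chilbert_space"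
  assumes A: "bounded_clinear A" and B: "bounded_clinear B"
    and U: "unitary_iso U" and U': "unitary_iso U'" and int: "\<And>x. U' (A x) = B (U x)"
  shows "U (absop A x) = absop B (U x)"
proof -
  define P where "P x = inv U (absop B (U x))" for x
  have UP: "U (P x) = absop B (U x)" for x
    using unitary_isoD(2) [OF U] by (simp add: P_def bij_is_surj surj_f_inv_f)
  have "absop A = P"
  proof (rule absop_eqI [OF A])
    show "bounded_clinear P"
      unfolding P_def
      by (intro bounded_clinear_compose [OF unitary_isoD(4) [OF unitary_iso_inv [OF U]]]
          bounded_clinear_compose [OF bounded_clinear_absop [OF B]] unitary_isoD(4) [OF U])
    have "cinner x (P x) = cinner (U x) (absop B (U x))" for x
      using unitary_isoD(5) [OF U, of x "P x"] by (simp add: UP)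
    then show "positive_op P"
      using positive_absop [OF B] by (simp add: positive_op_def)
    show "P (P x) = adj A (A x)" for x
    proof (rule cinner_ext)
      fix z
      have "cinner z (P (P x)) = cinner (U z) (adj B (B (U x)))"
        using unitary_isoD(5) [OF U, of z "P (P x)"] by (simp add: UP absop_square [OF B])
      also have "\<dots> = cinner (U' (A z)) (U' (A x))"
        by (simp add: int flip: cinner_adj [OF B])
      also have "\<dots> = cinner z (adj A (A x))"
        by (simp add: unitary_isoD(5) [OF U'] cinner_adj [OF A])
      finally show "cinner z (P (P x)) = cinner z (adj A (A x))" .
    qed
  qed
  then show ?thesis
    by (simp add: UP)
qed

text \<open>Trades the conjugation formula of the theorem for the intertwining form in which all
  arguments are carried out.\<close>

lemma absop_eq_conjugate_iff:
  assumes U: "unitary_iso U"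
  shows "absop A = adj U \<circ> absop B \<circ> U \<longleftrightarrow> (\<forall>x. U (absop A x) = absop B (U x))"
proof -
  have "x = inv U y \<longleftrightarrow> U x = y" for x y
    using unitary_isoD(2) [OF U] by (metis bij_inv_eq_iff)
  then show ?thesis
    by (simp add: fun_eq_iff adj_unitary [OF U])
qed

text \<open>Downward induction from \<open>k\<close>. The relation for \<open>Suc n\<close> is
  evaluated at \<open>W1 n x\<close>, the moduli are moved past the weights, and \<open>W2 n\<close>
  is cancelled.\<close>

lemma absop_intertwine_descends:
  fixes W1 :: "nat \<Rightarrow> 'a::chilbert_space \<Rightarrow> 'a" and W2 :: "nat \<Rightarrow> 'b::chilbert_space \<Rightarrow> 'b"
  assumes W2: "\<And>n. clinear (W2 n)"
    and ker1: "\<forall>n x. W1 n x = 0 \<longrightarrow> x = 0"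
    and comm1: "\<forall>m n. m < n \<longrightarrow> absop (W1 n) \<circ> W1 m = W1 m \<circ> absop (W1 n)"
    and comm2: "\<forall>m n. m < n \<longrightarrow> absop (W2 n) \<circ> W2 m = W2 m \<circ> absop (W2 n)"
    and D: "\<And>n. unitary_iso (D n)" and int: "\<And>n x. D (Suc n) (W1 n x) = W2 n (D n x)"
    and top: "\<And>x. D k (absop (W1 k) x) = absop (W2 k) (D k x)" and "n \<le> k"
  shows "D n (absop (W1 k) x) = absop (W2 k) (D n x)"
  using \<open>n \<le> k\<close>
proof (induction n arbitrary: x rule: inc_induct)
  case (step n)
  have ker2: "y = 0" if "W2 n y = 0" for y
  proof -
    obtain x where y: "y = D n x"
      using unitary_isoD(2) [OF D [of n]] by (metis bij_pointE)
    have "norm (W1 n x) = norm (W2 n y)"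
      by (simp add: y unitary_isoD(3) [OF D] flip: int)
    then have "x = 0"
      using that ker1 by simp
    then show ?thesis
      using unitary_isoD(3) [OF D [of n], of x] by (simp add: y)
  qed
  have c1: "absop (W1 k) (W1 n x) = W1 n (absop (W1 k) x)"
    using comm1 step(2) by (metis comp_apply)
  have c2: "absop (W2 k) (W2 n y) = W2 n (absop (W2 k) y)" for y
    using comm2 step(2) by (metis comp_apply)
  have "W2 n (D n (absop (W1 k) x)) = W2 n (absop (W2 k) (D n x))"
    using step.IH [of "W1 n x"] by (simp add: int c1 c2)
  then have "W2 n (D n (absop (W1 k) x) - absop (W2 k) (D n x)) = 0"
    by (simp add: clinear_diff W2)
  then show ?case
    using ker2 by (metis eq_iff_diff_eq_0)
qed (rule top)

text \<open>The relation in \<open>abs\<close> for \<open>k = n\<close> gives the equality of norms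
  from which \<open>U'\<close> is built; those for \<open>k > n\<close> pass to \<open>U'\<close> by
  commutation, first on the range of \<open>W1 n\<close>. Hence the range of \<open>k\<close>
  shrinks by one.\<close>

lemma absop_intertwine_step:
  fixes W1 :: "nat \<Rightarrow> 'a::chilbert_space \<Rightarrow> 'a" and W2 :: "nat \<Rightarrow> 'b::chilbert_space \<Rightarrow> 'b"
  assumes W1: "\<And>n. bounded_clinear (W1 n)" and W2: "\<And>n. bounded_clinear (W2 n)"
    and dense1: "\<forall>n. closure (range (W1 n)) = UNIV"
    and dense2: "\<forall>n. closure (range (W2 n)) = UNIV"
    and comm1: "\<forall>m n. m < n \<longrightarrow> absop (W1 n) \<circ> W1 m = W1 m \<circ> absop (W1 n)"
    and comm2: "\<forall>m n. m < n \<longrightarrow> absop (W2 n) \<circ> W2 m = W2 m \<circ> absop (W2 n)"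
    and U: "unitary_iso U"
    and abs: "\<forall>k\<ge>n. \<forall>x. U (absop (W1 k) x) = absop (W2 k) (U x)"
  obtains U' where "unitary_iso U'" "\<forall>x. U' (W1 n x) = W2 n (U x)"
    "\<forall>k\<ge>Suc n. \<forall>x. U' (absop (W1 k) x) = absop (W2 k) (U' x)"
proof -
  have lin: "clinear (W1 n)" "clinear (\<lambda>x. W2 n (U x))"
    using W1 W2 bounded_clinear_compose [OF W2 unitary_isoD(4) [OF U]]
    by (auto simp: bounded_clinear_clinear)
  have norm: "norm (W1 n x) = norm (W2 n (U x))" for x
  proof -
    have "norm (W1 n x) = norm (U (absop (W1 n) x))"
      by (simp add: unitary_isoD(3) [OF U] norm_absop W1)
    also have "\<dots> = norm (W2 n (U x))"
      using abs by (simp add: norm_absop W2)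
    finally show ?thesis .
  qed
  have "range (\<lambda>x. W2 n (U x)) = range (W2 n)"
    using unitary_isoD(2) [OF U] by (metis bij_is_surj image_image)
  then have "closure (range (\<lambda>x. W2 n (U x))) = UNIV"
    using dense2 by simp
  then obtain U' where U': "unitary_iso U'" and int: "\<And>x. U' (W1 n x) = W2 n (U x)"
    using unitary_extension [OF lin norm] dense1 by blast
  have "U' (absop (W1 k) y) = absop (W2 k) (U' y)" if "Suc n \<le> k" for k y
  proof (rule eq_on_dense [of "\<lambda>y. U' (absop (W1 k) y)"])
    show "closure (range (W1 n)) = UNIV"
      using dense1 by blast
    show "continuous_on UNIV (\<lambda>y. U' (absop (W1 k) y))"
      by (intro linear_continuous_on bounded_clinear_bounded_linear
          bounded_clinear_compose [OF unitary_isoD(4) [OF U']] bounded_clinear_absop W1)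
    show "continuous_on UNIV (\<lambda>y. absop (W2 k) (U' y))"
      by (intro linear_continuous_on bounded_clinear_bounded_linear
          bounded_clinear_compose [OF bounded_clinear_absop] W2 unitary_isoD(4) [OF U'])
    fix x
    have "absop (W1 k) (W1 n x) = W1 n (absop (W1 k) x)"
      using comm1 that by (metis comp_apply Suc_le_eq)
    moreover have "absop (W2 k) (W2 n (U x)) = W2 n (absop (W2 k) (U x))"
      using comm2 that by (metis comp_apply Suc_le_eq)
    ultimately show "U' (absop (W1 k) (W1 n x)) = absop (W2 k) (U' (W1 n x))"
      using abs that by (simp add: int)
  qed
  then show thesis
    using U' int that by blast
qed

theorem mainTheorem8:
  fixes W1 :: "nat \<Rightarrow> 'a::chilbert_space \<Rightarrow> 'a"
    and W2 :: "nat \<Rightarrow> 'b::chilbert_space \<Rightarrow> 'b"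
  assumes nz1: "\<exists>x::'a. x \<noteq> 0" and nz2: "\<exists>y::'b. y \<noteq> 0"
    and w1: "weight_seq W1" and w2: "weight_seq W2"
    and ker1: "\<forall>n x. W1 n x = 0 \<longrightarrow> x = 0"
    and dense1: "\<forall>n. closure (range (W1 n)) = UNIV"
    and dense2: "\<forall>n. closure (range (W2 n)) = UNIV"
    and comm1: "\<forall>m n. m < n \<longrightarrow> absop (W1 n) \<circ> W1 m = W1 m \<circ> absop (W1 n)"
    and comm2: "\<forall>m n. m < n \<longrightarrow> absop (W2 n) \<circ> W2 m = W2 m \<circ> absop (W2 n)"
  shows "shift_unitarily_equiv W1 W2 \<longleftrightarrow>
         (\<exists>U0 :: 'a \<Rightarrow> 'b. unitary_iso U0 \<and>
            (\<forall>n. absop (W1 n) = adj U0 \<circ> absop (W2 n) \<circ> U0))"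
proof
  have W1: "bounded_clinear (W1 n)" and W2: "bounded_clinear (W2 n)" for n
    using w1 w2 by (auto simp: weight_seq_def)
  {
    assume "shift_unitarily_equiv W1 W2"
    then obtain D :: "nat \<Rightarrow> 'a \<Rightarrow> 'b" where D: "\<And>n. unitary_iso (D n)"
      and int: "\<And>n x. D (Suc n) (W1 n x) = W2 n (D n x)"
      using intertwiner_diagonal [OF _ w1 w2 dense1 dense2] by blast
    have "D k (absop (W1 k) x) = absop (W2 k) (D k x)" for k x
      by (rule absop_unitary_intertwine [OF W1 W2 D D int])
    \<comment> \<open>So far each modulus is intertwined by its own unitary; descending to index 0
      gives one unitary for all \<open>k\<close>.\<close>
    then have "D 0 (absop (W1 k) x) = absop (W2 k) (D 0 x)" for k x
      by (rule absop_intertwine_descends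
          [OF bounded_clinear_clinear [OF W2] ker1 comm1 comm2 D int _ le0])
    then show "\<exists>U0 :: 'a \<Rightarrow> 'b. unitary_iso U0 \<and>
        (\<forall>n. absop (W1 n) = adj U0 \<circ> absop (W2 n) \<circ> U0)"
      using D absop_eq_conjugate_iff by blast
  next
    assume "\<exists>U0 :: 'a \<Rightarrow> 'b. unitary_iso U0 \<and>
        (\<forall>n. absop (W1 n) = adj U0 \<circ> absop (W2 n) \<circ> U0)"
    then obtain U0 :: "'a \<Rightarrow> 'b" where U0: "unitary_iso U0"
      and abs0: "\<forall>k x. U0 (absop (W1 k) x) = absop (W2 k) (U0 x)"
      using absop_eq_conjugate_iff by blast
    \<comment> \<open>The invariant of the recursive construction, matching the assumptions of
      \<open>absop_intertwine_step\<close> on its unitary. Each new unitary depends on the previous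
      one, so dependent choice yields the diagonal.\<close>
    define good where "good n U \<longleftrightarrow> unitary_iso U \<and>
        (\<forall>k\<ge>n. \<forall>x. U (absop (W1 k) x) = absop (W2 k) (U x))" for n and U :: "'a \<Rightarrow> 'b"
    have "\<exists>U'. good (Suc n) U' \<and> (\<forall>x. U' (W1 n x) = W2 n (U x))" if "good n U" for n U
      using that absop_intertwine_step [OF W1 W2 dense1 dense2 comm1 comm2]
      unfolding good_def by metis
    moreover have "good 0 U0"
      using U0 abs0 by (simp add: good_def)
    ultimately obtain D where "\<And>n. good n (D n)" "\<And>n x. D (Suc n) (W1 n x) = W2 n (D n x)"
      using dependent_nat_choice [of good "\<lambda>n U U'. \<forall>x. U' (W1 n x) = W2 n (U x)"] by blast
    then show "shift_unitarily_equiv W1 W2"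
      by (intro diagonal_shift_equiv [of D]) (auto simp: good_def)
  }
qed

end
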